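(* Let $k=k_n$ be positive integers with $n>2k$ and $k\to\infty$ as $n\to\infty$, and let $r=r_n$ be integers with $1\le r\le k-1$. Let a random family of $k$-element subsets of an $n$-element set be obtained by selecting each of the $\binom{n}{k}$ $k$-sets independently with probability $p=p_n\in[0,1]$, and let $X_r$ be the number of unordered pairs of distinct selected sets which overlap in exactly $r$ elements. If $$p=o\left(\frac{1}{\binom{k}{r}\binom{n-k}{k-r}}\right)\quad\text{as } n\to\infty,$$ then, with $\lambda_r=\mathbb{E}(X_r)=\frac12\binom{n}{k}\binom{k}{r}\binom{n-k}{k-r}p^2$, $$d_{TV}\big(\mathcal{L}(X_r),\mathrm{Po}(\lambda_r)\big)\to 0\quad\text{as } n\to\infty.$$
   Context: $\mathcal{L}(Z)$ denotes the distribution of the random variable $Z$, $\mathrm{Po}(\lambda)$ the Poisson distribution with mean $\lambda$ (the point mass at $0$ if $\lambda=0$), and $d_{TV}$ the total variation distance between probability distributions, $d_{TV}(\mu,\nu)=\sup_B|\mu(B)-\nu(B)|$. Two sets overlap in exactly $r$ elements if their intersection has cardinality $r$. *)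

theory Defs
  imports "HOL-Probability.Probability" "HOL-Library.Landau_Symbols" "HOL-Library.Ramsey"
begin

definition random_family :: "'a set \<Rightarrow> nat \<Rightarrow> real \<Rightarrow> 'a set set pmf" where
  "random_family V k p =
     map_pmf (\<lambda>sel. {S \<in> nsets V k. sel S}) (Pi_pmf (nsets V k) False (\<lambda>_. bernoulli_pmf p))"

definition overlap_pairs :: "nat \<Rightarrow> 'a set set \<Rightarrow> 'a set set set" where
  "overlap_pairs r F = {{S, T} | S T. S \<in> F \<and> T \<in> F \<and> S \<noteq> T \<and> card (S \<inter> T) = r}"

definition overlap_count :: "nat \<Rightarrow> 'a set set \<Rightarrow> nat" where
  "overlap_count r F = card (overlap_pairs r F)"

(* The library's poisson_pmf is only specified for a strictly positive rate. *)
definition Po :: "real \<Rightarrow> nat pmf" where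
  "Po l = (if l = 0 then return_pmf 0 else poisson_pmf l)"

(* The differences are bounded by 1, so the real-valued supremum is the actual one. *)
definition d_TV :: "'a pmf \<Rightarrow> 'a pmf \<Rightarrow> real" where
  "d_TV P Q = (SUP B. \<bar>measure_pmf.prob P B - measure_pmf.prob Q B\<bar>)"

end

theory Submission
  imports Defs
begin

text \<open>
  Join two \<open>k\<close>-sets by an edge when they overlap in exactly \<open>r\<close> elements. This graph on the
  \<open>k\<close>-sets is \<open>D\<close>-regular with \<open>D = (k choose r) * (n - k choose k - r)\<close>, and \<open>X\<^sub>r\<close> counts the edges
  spanned by a random set of vertices into which each vertex is put independently with probability
  \<open>p\<close>. The hypothesis says precisely that \<open>D * p\<close> tends to 0, so it suffices that for every finite
  graph of maximum degree at most \<open>D\<close> the number of spanned edges is within total variation distance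
  \<open>2 * D * p\<close> of a Poisson variable with the same mean (\<open>d_TV_spanned_edges_Poisson\<close>).
  Regularity and a double count give the value of the mean (\<open>card_overlap_pairs\<close>).

  The bound comes from the Stein-Chen method. Let \<open>X F\<close> be the number of edges spanned by \<open>F\<close>, and
  let \<open>l\<close>, the number of edges times \<open>p\<^sup>2\<close>, be its mean. For a set \<open>A\<close> of counts let \<open>g\<close> solve
  \<open>l * g (j + 1) - j * g j = indicator A j - Po(l)(A)\<close>. Putting \<open>j = X F\<close> and taking expectations,
  the right side becomes the error made on \<open>A\<close>. On the left, \<open>X F\<close> is the sum over the edges \<open>e\<close> of
  the indicators of \<open>e \<subseteq> F\<close>, and conditioning on \<open>e \<subseteq> F\<close> amounts to replacing \<open>F\<close> by \<open>F \<union> e\<close>, because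
  the vertices are chosen independently (\<open>expectation_random_subset_containing\<close>). The error is
  therefore the sum over \<open>e\<close> of \<open>p\<^sup>2\<close> times the expectation of \<open>g (X F + 1) - g (X (F \<union> e))\<close>.

  Two facts make this small. First, \<open>X F + 1\<close> and \<open>X (F \<union> e)\<close> differ at most by the number of
  neighbours in \<open>F\<close> of the two ends of \<open>e\<close> (\<open>spanned_edges_add_edge\<close>), which is at most \<open>2 * D * p\<close>
  on average. Second, \<open>g\<close> has increments of size at most \<open>1 / l\<close> on the positive integers
  (\<open>poisson_stein_lipschitz\<close>). As \<open>l\<close> is the number of edges times \<open>p\<^sup>2\<close>, the factor \<open>1 / l\<close> exactly
  absorbs the sum over all edges; this is why the bound is good however large the mean is.
\<close>

section \<open>The Stein equation of the Poisson distribution\<close>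

lemma pmf_poisson_Suc:
  assumes "0 < l"
  shows "real (Suc j) * pmf (poisson_pmf l) (Suc j) = l * pmf (poisson_pmf l) j"
proof -
  have "fact (Suc j) = real (Suc j) * fact j" by simp
  then show ?thesis using assms by (simp add: field_simps del: of_nat_Suc fact_Suc)
qed

text \<open>Consecutive Poisson weights have ratio \<open>l / (j + 1)\<close>, which decreases in \<open>j\<close>. Everything
  needed about the tails follows from this.\<close>

lemma poisson_log_concave:
  assumes l: "0 < l" and "i \<le> j"
  shows "pmf (poisson_pmf l) i * pmf (poisson_pmf l) (Suc j)
       \<le> pmf (poisson_pmf l) (Suc i) * pmf (poisson_pmf l) j"
proof -
  let ?q = "pmf (poisson_pmf l)"
  have S: "?q (Suc m) = l * ?q m / real (Suc m)" for m
    using pmf_poisson_Suc[OF l, of m] by (simp add: field_simps)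
  have "?q i * ?q (Suc j) = (l * ?q i * ?q j) / real (Suc j)" by (simp only: S) simp
  also have "\<dots> \<le> (l * ?q i * ?q j) / real (Suc i)"
    using assms by (intro divide_left_mono mult_nonneg_nonneg) auto
  also have "\<dots> = ?q (Suc i) * ?q j" by (simp only: S) simp
  finally show ?thesis .
qed

text \<open>Log-concavity compares the two tails term by term. It says that the
  tail above \<open>i\<close>, measured relative to the weight at \<open>i\<close>, decreases in \<open>i\<close>.\<close>

lemma poisson_upper_tail_ratio:
  assumes l: "0 < l"
  shows "pmf (poisson_pmf l) i * measure_pmf.prob (poisson_pmf l) {Suc i<..}
       \<le> pmf (poisson_pmf l) (Suc i) * measure_pmf.prob (poisson_pmf l) {i<..}"
proof -
  let ?q = "pmf (poisson_pmf l)" and ?P = "measure_pmf.prob (poisson_pmf l)"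
  have tail: "(\<lambda>m. ?q (Suc (m + i))) sums ?P {i<..}" for i
  proof -
    have "(\<lambda>m. ?P {Suc (m + i)}) sums ?P (\<Union>m. {Suc (m + i)})"
      by (intro measure_pmf.finite_measure_UNION) (auto simp: disjoint_family_on_def)
    moreover have "(\<Union>m. {Suc (m + i)}) = {i<..}"
    proof (intro equalityI subsetI)
      fix x assume "x \<in> {i<..}"
      then have "x = Suc ((x - Suc i) + i)" by simp
      then show "x \<in> (\<Union>m. {Suc (m + i)})" by blast
    qed auto
    ultimately show ?thesis by (simp add: measure_pmf_single)
  qed
  show ?thesis
  proof (rule sums_le)
    show "(\<lambda>m. ?q i * ?q (Suc (m + Suc i))) sums (?q i * ?P {Suc i<..})"
      by (intro sums_mult tail)
    show "(\<lambda>m. ?q (Suc i) * ?q (Suc (m + i))) sums (?q (Suc i) * ?P {i<..})"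
      by (intro sums_mult tail)
    show "?q i * ?q (Suc (m + Suc i)) \<le> ?q (Suc i) * ?q (Suc (m + i))" for m
      using poisson_log_concave[OF l, of i "Suc (m + i)"] by simp
  qed
qed

text \<open>The counterpart for the lower tail: the right side has one term more than
  the left, namely the weight at 0, and log-concavity compares the other terms.\<close>

lemma poisson_lower_tail_ratio:
  assumes l: "0 < l"
  shows "pmf (poisson_pmf l) (Suc i) * measure_pmf.prob (poisson_pmf l) {..i}
       \<le> pmf (poisson_pmf l) i * measure_pmf.prob (poisson_pmf l) {..Suc i}"
proof -
  let ?q = "pmf (poisson_pmf l)" and ?P = "measure_pmf.prob (poisson_pmf l)"
  have "?q (Suc i) * ?P {..i} = (\<Sum>m\<le>i. ?q m * ?q (Suc i))"
    by (simp add: measure_measure_pmf_finite sum_distrib_left mult.commute)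
  also have "\<dots> \<le> (\<Sum>m\<le>i. ?q (Suc m) * ?q i)"
    by (intro sum_mono poisson_log_concave[OF l]) auto
  also have "\<dots> \<le> ?q 0 * ?q i + (\<Sum>m\<le>i. ?q (Suc m) * ?q i)"
    by simp
  also have "\<dots> = ?q i * (\<Sum>m\<le>Suc i. ?q m)"
    by (simp only: sum.atMost_Suc_shift) (simp add: sum_distrib_left algebra_simps)
  also have "\<dots> = ?q i * ?P {..Suc i}"
    by (simp only: measure_measure_pmf_finite finite_atMost)
  finally show ?thesis .
qed

text \<open>Multiplying the Stein equation at \<open>j\<close> by the Poisson weight of \<open>j\<close> makes its left side
  telescope, so summing over \<open>j \<le> i\<close> gives the value at \<open>Suc i\<close>. The equation does not determine the
  value at 0, where \<open>g\<close> is multiplied by \<open>j = 0\<close>; it is set to 0.\<close>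

definition poisson_stein :: "real \<Rightarrow> nat set \<Rightarrow> nat \<Rightarrow> real" where
  "poisson_stein l A j = (case j of 0 \<Rightarrow> 0 | Suc i \<Rightarrow>
     (measure_pmf.prob (poisson_pmf l) (A \<inter> {..i})
      - measure_pmf.prob (poisson_pmf l) A * measure_pmf.prob (poisson_pmf l) {..i})
     / (l * pmf (poisson_pmf l) i))"

lemma poisson_stein_equation:
  assumes l: "0 < l"
  shows "l * poisson_stein l A (Suc j) - real j * poisson_stein l A j
       = indicator A j - measure_pmf.prob (poisson_pmf l) A"
proof -
  let ?q = "pmf (poisson_pmf l)" and ?P = "measure_pmf.prob (poisson_pmf l)"
  have q: "?q i > 0" for i using l by simp
  show ?thesis
  proof (cases j)
    case 0
    have "?P (A \<inter> {..0}) = indicator A 0 * ?q 0"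
      by (cases "0 \<in> A") (auto simp: measure_pmf_single)
    moreover have "?P {..0} = ?q 0" by (simp add: measure_pmf_single)
    ultimately show ?thesis using 0 l q[of 0]
      by (simp add: poisson_stein_def field_simps del: pmf_poisson)
  next
    case (Suc i)
    have fin: "?P {..Suc i} = ?P {..i} + ?q (Suc i)"
      by (simp add: measure_measure_pmf_finite del: pmf_poisson)
    have finA: "?P (A \<inter> {..Suc i}) = ?P (A \<inter> {..i}) + indicator A (Suc i) * ?q (Suc i)"
    proof (cases "Suc i \<in> A")
      case True
      have "A \<inter> {..Suc i} = insert (Suc i) (A \<inter> {..i})" using True by auto
      then show ?thesis using True by (simp add: measure_measure_pmf_finite del: pmf_poisson)
    next
      case False
      have "A \<inter> {..Suc i} = A \<inter> {..i}" using False by (auto simp: le_Suc_eq)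
      then show ?thesis using False by simp
    qed
    define x where "x = ?P (A \<inter> {..i}) - ?P A * ?P {..i}"
    define c where "c = ?q (Suc i)"
    have c: "c > 0" "l * ?q i = real (Suc i) * c"
      using q pmf_poisson_Suc[OF l, of i] by (simp_all add: c_def del: pmf_poisson)
    have "poisson_stein l A (Suc (Suc i)) = (x + (indicator A (Suc i) - ?P A) * c) / (l * c)"
      by (simp add: poisson_stein_def fin finA x_def c_def algebra_simps del: pmf_poisson)
    then have "l * poisson_stein l A (Suc (Suc i)) = (x + (indicator A (Suc i) - ?P A) * c) / c"
      using l by simp
    moreover have "real (Suc i) * poisson_stein l A (Suc i) = x / c"
      using c(1) by (simp add: poisson_stein_def c(2) x_def del: pmf_poisson of_nat_Suc)
    ultimately show ?thesis using c(1) Suc by (simp add: add_divide_distrib del: of_nat_Suc)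
  qed
qed

text \<open>Turns an upper bound on the increments, valid for all \<open>A\<close>, into a lower bound.\<close>

lemma poisson_stein_compl: "poisson_stein l (- A) j = - poisson_stein l A j"
proof (cases j)
  case (Suc i)
  let ?P = "measure_pmf.prob (poisson_pmf l)"
  have compl: "?P (- A) = 1 - ?P A"
    by (simp add: measure_pmf.prob_compl[simplified, symmetric] Compl_eq_Diff_UNIV)
  have "?P {..i} = ?P (A \<inter> {..i}) + ?P (- A \<inter> {..i})"
    by (subst measure_pmf.finite_measure_Union[symmetric]) (auto intro: arg_cong[of _ _ ?P])
  then have split: "?P (- A \<inter> {..i}) = ?P {..i} - ?P (A \<inter> {..i})" by simp
  show ?thesis unfolding Suc poisson_stein_def nat.case minus_divide_left compl split
    by (simp add: algebra_simps)
qed (simp add: poisson_stein_def)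

text \<open>The increment is additive in \<open>A\<close>. Points of \<open>A\<close> below and above \<open>Suc i\<close> contribute a
  nonpositive amount, because the relative tails \<open>H\<close> and \<open>L\<close> are monotone, so the increment is
  largest when \<open>A\<close> consists of the point \<open>Suc i\<close> alone. For that set it is at most the total Poisson
  mass divided by \<open>l\<close>.\<close>

lemma poisson_stein_increment_upper:
  assumes l: "0 < l"
  shows "poisson_stein l A (Suc (Suc i)) - poisson_stein l A (Suc i) \<le> 1 / l"
proof -
  let ?q = "pmf (poisson_pmf l)" and ?P = "measure_pmf.prob (poisson_pmf l)"
  have q: "?q i > 0" for i using l by simp
  have un: "?P (B \<union> C) = ?P B + ?P C" if "B \<inter> C = {}" for B C
    using that by (intro measure_pmf.finite_measure_Union) auto
  define H where "H i = ?P {i<..} / (l * ?q i)" for i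
  define L where "L i = ?P {..i} / (l * ?q i)" for i
  have full: "?P {..i} + ?P {i<..} = 1" for i
  proof -
    have "{..i} \<union> {i<..} = UNIV" "{..i} \<inter> {i<..} = {}" by auto
    then show ?thesis using un[of "{..i}" "{i<..}"] by simp
  qed
  \<comment> \<open>Splitting the mass of \<open>A\<close> at \<open>i\<close> makes the signs of the two contributions visible.\<close>
  have sol: "poisson_stein l A (Suc i) = ?P (A \<inter> {..i}) * H i - ?P (A \<inter> {i<..}) * L i" for i
  proof -
    have A: "?P A = ?P (A \<inter> {..i}) + ?P (A \<inter> {i<..})"
      by (subst un[symmetric]) (auto intro: arg_cong[of _ _ ?P])
    have t: "?P {i<..} = 1 - ?P {..i}" using full[of i] by simp
    show ?thesis
      unfolding poisson_stein_def H_def L_def A t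
      by (simp add: diff_divide_distrib[symmetric] algebra_simps del: pmf_poisson)
  qed
  define x where "x = ?P (A \<inter> {..i})"
  define y where "y = ?P (A \<inter> {Suc i})"
  define z where "z = ?P (A \<inter> {Suc i<..})"
  have xy: "?P (A \<inter> {..Suc i}) = x + y" unfolding x_def y_def
    by (subst un[symmetric]) (auto intro!: arg_cong[of _ _ ?P])
  have yz: "?P (A \<inter> {i<..}) = y + z" unfolding z_def y_def
    by (subst un[symmetric]) (auto intro!: arg_cong[of _ _ ?P])
  have y: "y \<le> ?q (Suc i)"
    unfolding y_def measure_pmf_single[symmetric] by (intro measure_pmf.finite_measure_mono) auto
  have Hdec: "H (Suc i) \<le> H i"
    using poisson_upper_tail_ratio[OF l, of i] l q[of i] q[of "Suc i"] unfolding H_def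
    by (simp add: divide_simps del: pmf_poisson) (simp add: mult_ac del: pmf_poisson)
  have Linc: "L i \<le> L (Suc i)"
    using poisson_lower_tail_ratio[OF l, of i] l q[of i] q[of "Suc i"] unfolding L_def
    by (simp add: divide_simps del: pmf_poisson) (simp add: mult_ac del: pmf_poisson)
  have HL: "0 \<le> H (Suc i) + L i"
    using l q[of i] q[of "Suc i"] unfolding H_def L_def
    by (intro add_nonneg_nonneg divide_nonneg_nonneg) auto
  have "poisson_stein l A (Suc (Suc i)) - poisson_stein l A (Suc i)
      = x * (H (Suc i) - H i) + y * (H (Suc i) + L i) - z * (L (Suc i) - L i)"
    unfolding sol xy yz x_def[symmetric] z_def[symmetric] by (simp add: algebra_simps)
  also have "\<dots> \<le> y * (H (Suc i) + L i)"
  proof -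
    have "x * (H (Suc i) - H i) \<le> 0" "0 \<le> z * (L (Suc i) - L i)"
      using Hdec Linc unfolding x_def z_def
      by (auto intro!: mult_nonneg_nonneg mult_nonneg_nonpos)
    then show ?thesis by linarith
  qed
  also have "\<dots> \<le> ?q (Suc i) * (H (Suc i) + L i)"
    by (intro mult_right_mono y HL)
  also have "\<dots> = (?P {Suc i<..} + ?q (Suc i) * ?P {..i} / ?q i) / l"
    using l q[of i] q[of "Suc i"] unfolding H_def L_def by (simp add: field_simps del: pmf_poisson)
  also have "\<dots> \<le> (?P {Suc i<..} + ?P {..Suc i}) / l"
    using poisson_lower_tail_ratio[OF l, of i] l q[of i]
    by (intro divide_right_mono add_left_mono) (simp_all add: field_simps del: pmf_poisson)
  also have "\<dots> = 1 / l" using full[of "Suc i"] by simp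
  finally show ?thesis .
qed

text \<open>Only positive arguments are compared: the increment from 0 to 1 depends on the
  arbitrary value at 0.\<close>

lemma poisson_stein_lipschitz:
  assumes l: "0 < l"
  shows "\<bar>poisson_stein l A (Suc a) - poisson_stein l A (Suc b)\<bar> \<le> \<bar>real a - real b\<bar> / l"
proof -
  have step: "\<bar>poisson_stein l A (Suc (Suc i)) - poisson_stein l A (Suc i)\<bar> \<le> 1 / l" for i
    using poisson_stein_increment_upper[OF l, of A i] poisson_stein_increment_upper[OF l, of "- A" i]
    by (simp add: poisson_stein_compl abs_le_iff)
  have up: "\<bar>poisson_stein l A (Suc (i + d)) - poisson_stein l A (Suc i)\<bar> \<le> real d / l" for i d
  proof (induction d)
    case (Suc d)
    then show ?case using step[of "i + d"] by (simp add: add_divide_distrib)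
  qed simp
  show ?thesis
  proof (cases "a \<le> b")
    case True
    then show ?thesis using up[of a "b - a"] by (simp add: abs_minus_commute of_nat_diff)
  next
    case False
    then show ?thesis using up[of b "a - b"] by (simp add: of_nat_diff)
  qed
qed

section \<open>Random subsets\<close>

definition random_subset :: "'b set \<Rightarrow> real \<Rightarrow> 'b set pmf" where
  "random_subset W p = map_pmf (\<lambda>sel. {x \<in> W. sel x}) (Pi_pmf W False (\<lambda>_. bernoulli_pmf p))"

lemma finite_set_pmf_random_subset: "finite W \<Longrightarrow> finite (set_pmf (random_subset W p))"
  by (rule finite_subset[of _ "Pow W"]) (auto simp: random_subset_def)

lemma integrable_random_subset [simp]:
  "finite W \<Longrightarrow> integrable (measure_pmf (random_subset W p)) (f :: _ \<Rightarrow> real)"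
  by (intro integrable_measure_pmf_finite finite_set_pmf_random_subset)

text \<open>Revealing whether \<open>u\<close> is selected first leaves a random subset of the other elements.\<close>

lemma random_subset_insert:
  assumes "finite W" "u \<notin> W"
  shows "random_subset (insert u W) p =
    bind_pmf (bernoulli_pmf p) (\<lambda>b. map_pmf (\<lambda>F. if b then insert u F else F) (random_subset W p))"
proof -
  have eq: "{x. (x = u \<or> x \<in> W) \<and> (if x = u then b else f x)}
     = (if b then insert u {x \<in> W. f x} else {x \<in> W. f x})" for b f
    using assms(2) by auto
  show ?thesis
    unfolding random_subset_def
    by (subst Pi_pmf_insert[OF assms])
       (simp add: pair_pmf_def map_pmf_def bind_assoc_pmf bind_return_pmf eq)
qed

text \<open>Whether \<open>u\<close> is selected is independent of the rest of \<open>F\<close>, and \<open>insert u F\<close> depends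
  only on that rest.\<close>

lemma expectation_random_subset_containing_vertex:
  fixes h :: "'b set \<Rightarrow> real"
  assumes W: "finite W" "u \<in> W" and p: "0 \<le> p" "p \<le> 1"
  shows "measure_pmf.expectation (random_subset W p) (\<lambda>F. of_bool (u \<in> F) * h F)
       = p * measure_pmf.expectation (random_subset W p) (\<lambda>F. h (insert u F))"
proof -
  define U where "U = W - {u}"
  have U: "finite U" "u \<notin> U" "W = insert u U" using W by (auto simp: U_def)
  let ?M = "random_subset U p"
  have notin: "u \<notin> F" if "F \<in> set_pmf ?M" for F
    using that U by (auto simp: random_subset_def)
  have ex: "measure_pmf.expectation (random_subset W p) f
     = p * measure_pmf.expectation ?M (\<lambda>F. f (insert u F))
       + (1 - p) * measure_pmf.expectation ?M f" for f :: "'b set \<Rightarrow> real"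
    unfolding U(3) random_subset_insert[OF U(1,2)] using p U(1)
    by (subst pmf_expectation_bind[where A = UNIV])
       (auto simp: finite_set_pmf_random_subset UNIV_bool)
  have "measure_pmf.expectation ?M (\<lambda>F. of_bool (u \<in> F) * h F) = 0"
    using notin by (subst integral_cong_AE[where g = "\<lambda>_. 0"]) (auto simp: AE_measure_pmf_iff)
  then show ?thesis unfolding ex by (simp add: algebra_simps)
qed

text \<open>Conditioning on \<open>B \<subseteq> F\<close> has the same effect as adding \<open>B\<close> to an unconditioned \<open>F\<close>. This
  explicit coupling is what the Stein-Chen method needs.\<close>

lemma expectation_random_subset_containing:
  fixes h :: "'b set \<Rightarrow> real"
  assumes W: "finite W" and p: "0 \<le> p" "p \<le> 1" and "B \<subseteq> W"
  shows "measure_pmf.expectation (random_subset W p) (\<lambda>F. of_bool (B \<subseteq> F) * h F)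
       = p ^ card B * measure_pmf.expectation (random_subset W p) (\<lambda>F. h (F \<union> B))"
proof -
  have "finite B" using assms finite_subset by blast
  then show ?thesis using \<open>B \<subseteq> W\<close>
  proof (induction B arbitrary: h rule: finite_induct)
    case (insert u B)
    let ?E = "measure_pmf.expectation (random_subset W p)"
    have uW: "u \<in> W" and BW: "B \<subseteq> W" using insert.prems by auto
    have "?E (\<lambda>F. of_bool (insert u B \<subseteq> F) * h F)
        = ?E (\<lambda>F. of_bool (u \<in> F) * (of_bool (B \<subseteq> F) * h F))"
      by (intro Bochner_Integration.integral_cong) auto
    also have "\<dots> = p * ?E (\<lambda>F. of_bool (B \<subseteq> insert u F) * h (insert u F))"
      by (rule expectation_random_subset_containing_vertex[OF W uW p])
    also have "(\<lambda>F. of_bool (B \<subseteq> insert u F) * h (insert u F))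
             = (\<lambda>F. of_bool (B \<subseteq> F) * h (insert u F))"
      using insert.hyps by (auto simp: subset_insert)
    also have "?E \<dots> = p ^ card B * ?E (\<lambda>F. h (insert u (F \<union> B)))"
      using insert.IH[OF BW, of "\<lambda>F. h (insert u F)"] by simp
    finally show ?case using insert.hyps by simp
  qed simp
qed

lemma prob_random_subset_containing:
  assumes "finite W" "0 \<le> p" "p \<le> 1" "B \<subseteq> W"
  shows "measure_pmf.expectation (random_subset W p) (\<lambda>F. of_bool (B \<subseteq> F)) = p ^ card B"
  using expectation_random_subset_containing[OF assms, of "\<lambda>_. 1"] by simp

section \<open>Edges spanned by a random set of vertices\<close>

definition spanned_edges :: "'b set set \<Rightarrow> 'b set \<Rightarrow> nat" where
  "spanned_edges E F = card {e \<in> E. e \<subseteq> F}"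

lemma spanned_edges_eq_sum:
  "finite E \<Longrightarrow> real (spanned_edges E F) = (\<Sum>e\<in>E. of_bool (e \<subseteq> F))"
  by (simp add: spanned_edges_def of_bool_def sum.If_cases Int_def)

lemma expectation_spanned_edges:
  assumes W: "finite W" and p: "0 \<le> p" "p \<le> 1" and E: "E \<subseteq> nsets W 2"
  shows "measure_pmf.expectation (random_subset W p) (\<lambda>F. real (spanned_edges E F))
       = real (card E) * p\<^sup>2"
proof -
  have fE: "finite E" using E W finite_imp_finite_nsets finite_subset by blast
  have "measure_pmf.expectation (random_subset W p) (\<lambda>F. real (spanned_edges E F))
     = (\<Sum>e\<in>E. measure_pmf.expectation (random_subset W p) (\<lambda>F. of_bool (e \<subseteq> F)))"
    using W fE by (simp add: spanned_edges_eq_sum del: sum_of_bool_eq)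
  also have "\<dots> = (\<Sum>e\<in>E. p\<^sup>2)"
  proof (rule sum.cong)
    fix e assume "e \<in> E"
    then have "e \<subseteq> W" "card e = 2" using E by (auto simp: nsets_def)
    then show "measure_pmf.expectation (random_subset W p) (\<lambda>F. of_bool (e \<subseteq> F)) = p\<^sup>2"
      using prob_random_subset_containing[OF W p, of e] by simp
  qed simp
  finally show ?thesis by simp
qed

text \<open>The inner sum counts the neighbours of \<open>u\<close> in \<open>F\<close>. Adding the ends of \<open>e\<close> creates the edge
  \<open>e\<close> and edges from an end of \<open>e\<close> to \<open>F\<close>, which gives the upper estimate. The lower estimate could
  only fail if no edge is created; then \<open>e\<close> already lies in \<open>F\<close>, and its ends are neighbours of each
  other in \<open>F\<close>. For this reason \<open>f\<close> may equal \<open>e\<close> in the sum.\<close>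

lemma spanned_edges_add_edge:
  assumes E: "finite E" "\<And>f. f \<in> E \<Longrightarrow> finite f \<and> card f = 2" and e: "e \<in> E"
  shows "\<bar>real (spanned_edges E (F \<union> e)) - (real (spanned_edges E F) + 1)\<bar>
     \<le> (\<Sum>u\<in>e. \<Sum>f\<in>{f\<in>E. u \<in> f}. of_bool (f - {u} \<subseteq> F))"
    (is "_ \<le> ?S")
proof -
  have fe: "finite e" "card e = 2" using E e by auto
  let ?N = "\<lambda>u. {f \<in> E. u \<in> f \<and> f - {u} \<subseteq> F}"
  have S: "?S = real (\<Sum>u\<in>e. card (?N u))"
    using E(1) by (simp add: of_bool_def sum.If_cases Int_def conj_assoc)
  let ?A = "{f \<in> E. f \<subseteq> F \<union> e}" and ?B = "{f \<in> E. f \<subseteq> F}"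
  have AB: "card ?B \<le> card ?A" by (rule card_mono) (use E in auto)
  have new: "?A \<subseteq> ?B \<union> {e} \<union> (\<Union>u\<in>e. ?N u)"
  proof
    fix f assume f: "f \<in> ?A"
    show "f \<in> ?B \<union> {e} \<union> (\<Union>u\<in>e. ?N u)"
    proof (cases "f \<subseteq> F \<or> f = e")
      case False
      then obtain u where u: "u \<in> f" "u \<notin> F" by auto
      then have ue: "u \<in> e" using f by auto
      have "f - {u} \<subseteq> F"
      proof
        fix v assume v: "v \<in> f - {u}"
        \<comment> \<open>Otherwise both ends of \<open>f\<close> lie in \<open>e\<close>, forcing \<open>f = e\<close>.\<close>
        show "v \<in> F"
        proof (rule ccontr)
          assume "v \<notin> F"
          then have "{u, v} \<subseteq> e" "{u, v} \<subseteq> f" "card {u, v} = 2" using v u f ue by auto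
          moreover have "finite f" "card f = 2" using E f by auto
          ultimately have "{u, v} = e" "{u, v} = f" using fe by (metis card_subset_eq)+
          then show False using False by simp
        qed
      qed
      then show ?thesis using f u ue by auto
    qed (use f in auto)
  qed
  have "card ?A \<le> card (?B \<union> {e} \<union> (\<Union>u\<in>e. ?N u))"
    using E(1) fe by (intro card_mono new) auto
  also have "\<dots> \<le> card ?B + 1 + (\<Sum>u\<in>e. card (?N u))"
    using card_Un_le[of "?B \<union> {e}" "\<Union>u\<in>e. ?N u"] card_Un_le[of ?B "{e}"] 
      card_UN_le[OF fe(1), of ?N] by simp
  finally have up: "card ?A \<le> card ?B + 1 + (\<Sum>u\<in>e. card (?N u))" .
  have low: "card ?B + 1 \<le> card ?A + (\<Sum>u\<in>e. card (?N u))"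
  proof (cases "e \<subseteq> F")
    case True
    obtain u where u: "u \<in> e" using fe by fastforce
    have "e \<in> ?N u" using e u True by auto
    then have "0 < card (?N u)" using E(1) by (subst card_gt_0_iff) auto
    also have "card (?N u) \<le> (\<Sum>u\<in>e. card (?N u))" using fe u by (intro member_le_sum) auto
    finally show ?thesis using AB by simp
  next
    case False
    have "?B \<subset> ?A" using e False by auto
    then have "card ?B < card ?A" using E(1) by (intro psubset_card_mono) auto
    then show ?thesis by simp
  qed
  show ?thesis unfolding S spanned_edges_def using up low by linarith
qed

text \<open>A real supremum of an unbounded family would be arbitrary, so boundedness has to be checked.\<close>

lemma d_TV_nonneg: "0 \<le> d_TV P Q"
proof -
  have "\<bar>measure_pmf.prob P B - measure_pmf.prob Q B\<bar> \<le> 1" for B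
    using measure_pmf.prob_le_1[of P B] measure_pmf.prob_le_1[of Q B]
      measure_nonneg[of P B] measure_nonneg[of Q B] by linarith
  then have "bdd_above (range (\<lambda>B. \<bar>measure_pmf.prob P B - measure_pmf.prob Q B\<bar>))"
    by (intro bdd_aboveI2[of _ _ 1]) auto
  then have "\<bar>measure_pmf.prob P {} - measure_pmf.prob Q {}\<bar> \<le> d_TV P Q"
    unfolding d_TV_def by (intro cSUP_upper) auto
  then show ?thesis by simp
qed

text \<open>The Stein-Chen estimate. Its size does not depend on the mean, because the sum over the edges
  yields a factor \<open>l\<close> which the Lipschitz constant \<open>1 / l\<close> of the Stein solution cancels.\<close>

theorem d_TV_spanned_edges_Poisson:
  fixes W :: "'b set" and E :: "'b set set" and D :: real
  assumes W: "finite W" and E: "E \<subseteq> nsets W 2" and p: "0 \<le> p" "p \<le> 1"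
    and deg: "\<And>u. u \<in> W \<Longrightarrow> real (card {e \<in> E. u \<in> e}) \<le> D" and D: "0 \<le> D"
  shows "d_TV (map_pmf (spanned_edges E) (random_subset W p)) (Po (real (card E) * p\<^sup>2)) \<le> 2 * D * p"
proof -
  define l where "l = real (card E) * p\<^sup>2"
  let ?M = "random_subset W p"
  let ?E = "measure_pmf.expectation ?M"
  let ?X = "spanned_edges E"
  have fE: "finite E" using E W finite_imp_finite_nsets finite_subset by blast
  have eE: "e \<subseteq> W" "finite e" "card e = 2" if "e \<in> E" for e
    using E that by (auto simp: nsets_def)
  have "l \<ge> 0" by (simp add: l_def)
  show ?thesis
  proof (cases "l = 0")
    case True
    \<comment> \<open>The Stein solution needs a positive rate. For mean 0 the count vanishes almost surely.\<close>
    have "?E (\<lambda>F. real (?X F)) = 0"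
      using expectation_spanned_edges[OF W p E] True by (simp add: l_def)
    then have "AE F in ?M. real (?X F) = 0"
      using W by (subst (asm) integral_nonneg_eq_0_iff_AE) auto
    then have "map_pmf ?X ?M = map_pmf (\<lambda>_. 0) ?M"
      by (intro map_pmf_cong) (auto simp: AE_measure_pmf_iff)
    then have "map_pmf ?X ?M = return_pmf 0" by simp
    then show ?thesis using True D p by (simp add: l_def[symmetric] Po_def d_TV_def)
  next
    case False
    with \<open>l \<ge> 0\<close> have l: "0 < l" by simp
    have "\<bar>measure_pmf.prob (map_pmf ?X ?M) A - measure_pmf.prob (poisson_pmf l) A\<bar> \<le> 2 * D * p" for A
    proof -
      let ?g = "poisson_stein l A"
      have "measure_pmf.prob (map_pmf ?X ?M) A = ?E (\<lambda>F. indicator A (?X F))"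
        by (subst integral_map_pmf[symmetric]) simp
      then have "measure_pmf.prob (map_pmf ?X ?M) A - measure_pmf.prob (poisson_pmf l) A
          = ?E (\<lambda>F. indicator A (?X F) - measure_pmf.prob (poisson_pmf l) A)"
        using W by simp
      also have "\<dots> = ?E (\<lambda>F. l * ?g (Suc (?X F)) - real (?X F) * ?g (?X F))"
        by (simp add: poisson_stein_equation[OF l])
      also have "\<dots> = l * ?E (\<lambda>F. ?g (Suc (?X F)))
          - ?E (\<lambda>F. \<Sum>e\<in>E. of_bool (e \<subseteq> F) * ?g (?X F))"
        using W fE by (simp add: spanned_edges_eq_sum sum_distrib_right)
      also have "?E (\<lambda>F. \<Sum>e\<in>E. of_bool (e \<subseteq> F) * ?g (?X F))
          = (\<Sum>e\<in>E. p\<^sup>2 * ?E (\<lambda>F. ?g (?X (F \<union> e))))"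
        using W eE by (simp add: expectation_random_subset_containing[OF W p])
      also have "l * ?E (\<lambda>F. ?g (Suc (?X F))) = (\<Sum>e\<in>E. p\<^sup>2 * ?E (\<lambda>F. ?g (Suc (?X F))))"
        by (simp add: l_def)
      also have "\<dots> - (\<Sum>e\<in>E. p\<^sup>2 * ?E (\<lambda>F. ?g (?X (F \<union> e))))
          = (\<Sum>e\<in>E. p\<^sup>2 * ?E (\<lambda>F. ?g (Suc (?X F)) - ?g (?X (F \<union> e))))"
        using W by (simp add: sum_subtractf right_diff_distrib)
      finally have "\<bar>measure_pmf.prob (map_pmf ?X ?M) A - measure_pmf.prob (poisson_pmf l) A\<bar>
          \<le> (\<Sum>e\<in>E. \<bar>p\<^sup>2 * ?E (\<lambda>F. ?g (Suc (?X F)) - ?g (?X (F \<union> e)))\<bar>)"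
        by simp
      also have "\<dots> \<le> (\<Sum>e\<in>E. p\<^sup>2 * (2 * D * p / l))"
      proof (rule sum_mono)
        fix e assume e: "e \<in> E"
        let ?R = "\<lambda>F. \<Sum>u\<in>e. \<Sum>f\<in>{f\<in>E. u \<in> f}. (of_bool (f - {u} \<subseteq> F) :: real)"
        have pt: "\<bar>?g (Suc (?X F)) - ?g (?X (F \<union> e))\<bar> \<le> ?R F / l" for F
        proof -
          \<comment> \<open>The edge \<open>e\<close> itself makes the second argument positive, as the Lipschitz bound requires.\<close>
          have "e \<in> {f \<in> E. f \<subseteq> F \<union> e}" using e by auto
          then have "0 < ?X (F \<union> e)" using fE unfolding spanned_edges_def by (subst card_gt_0_iff) auto
          then obtain b where b: "?X (F \<union> e) = Suc b" using gr0_implies_Suc by blast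
          have "\<bar>?g (Suc (?X F)) - ?g (Suc b)\<bar> \<le> \<bar>real (?X F) - real b\<bar> / l"
            by (rule poisson_stein_lipschitz[OF l])
          also have "\<bar>real (?X F) - real b\<bar> = \<bar>real (?X (F \<union> e)) - (real (?X F) + 1)\<bar>"
            by (simp add: b)
          also have "\<dots> \<le> ?R F"
            using spanned_edges_add_edge[OF fE _ e, of F] eE by auto
          finally show ?thesis using l by (simp add: b divide_right_mono)
        qed
        have "\<bar>?E (\<lambda>F. ?g (Suc (?X F)) - ?g (?X (F \<union> e)))\<bar>
            \<le> ?E (\<lambda>F. \<bar>?g (Suc (?X F)) - ?g (?X (F \<union> e))\<bar>)"
          by (rule integral_abs_bound)
        also have "\<dots> \<le> ?E (\<lambda>F. ?R F / l)"
          using W by (intro integral_mono pt) auto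
        also have "\<dots> = (\<Sum>u\<in>e. \<Sum>f\<in>{f\<in>E. u \<in> f}. ?E (\<lambda>F. of_bool (f - {u} \<subseteq> F))) / l"
          using W by simp
        also have "\<dots> = (\<Sum>u\<in>e. \<Sum>f\<in>{f\<in>E. u \<in> f}. p) / l"
        proof -
          have "?E (\<lambda>F. of_bool (f - {u} \<subseteq> F)) = p" if "f \<in> E" "u \<in> f" for f u
          proof -
            have "card (f - {u}) = 1" "f - {u} \<subseteq> W" using eE[OF that(1)] that by auto
            then show ?thesis using prob_random_subset_containing[OF W p] by simp
          qed
          then show ?thesis by simp
        qed
        also have "\<dots> \<le> (\<Sum>u\<in>e. D * p) / l"
          using l p deg eE(1)[OF e]
          by (intro divide_right_mono sum_mono) (auto intro!: mult_right_mono)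
        also have "\<dots> = 2 * D * p / l" using eE[OF e] by simp
        finally show "\<bar>p\<^sup>2 * ?E (\<lambda>F. ?g (Suc (?X F)) - ?g (?X (F \<union> e)))\<bar> \<le> p\<^sup>2 * (2 * D * p / l)"
          using mult_left_mono[of _ _ "p\<^sup>2"] by (simp only: abs_mult abs_power2 zero_le_power2)
      qed
      also have "\<dots> = l * (2 * D * p / l)" by (simp add: l_def)
      also have "\<dots> = 2 * D * p" using l by simp
      finally show ?thesis .
    qed
    then show ?thesis
      unfolding d_TV_def l_def[symmetric] Po_def using False by (simp add: cSUP_least)
  qed
qed

section \<open>The overlap graph on the k-subsets\<close>

lemma overlap_count_eq_spanned_edges:
  assumes "F \<subseteq> W"
  shows "overlap_count r F = spanned_edges (overlap_pairs r W) F"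
proof -
  have "overlap_pairs r F = {e \<in> overlap_pairs r W. e \<subseteq> F}"
    using assms unfolding overlap_pairs_def by blast
  then show ?thesis by (simp add: overlap_count_def spanned_edges_def)
qed

lemma overlap_pairs_subset_nsets: "overlap_pairs r W \<subseteq> nsets W 2"
  unfolding overlap_pairs_def by clarify (simp add: doubleton_in_nsets_2)

text \<open>Such a \<open>T\<close> is determined by its \<open>r\<close> elements inside \<open>S\<close> and its \<open>k - r\<close> elements outside.\<close>

lemma card_nsets_overlapping:
  assumes V: "finite V" and S: "S \<in> nsets V k" and "r \<le> k"
  shows "card {T \<in> nsets V k. card (S \<inter> T) = r}
       = (k choose r) * ((card V - k) choose (k - r))"
proof -
  have S': "S \<subseteq> V" "finite S" "card S = k" using S by (auto simp: nsets_def)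
  have "bij_betw (\<lambda>(A, B). A \<union> B) (nsets S r \<times> nsets (V - S) (k - r))
     {T \<in> nsets V k. card (S \<inter> T) = r}"
  proof (rule bij_betw_byWitness[where f' = "\<lambda>T. (S \<inter> T, T - S)"])
    show "(\<lambda>(A, B). A \<union> B) ` (nsets S r \<times> nsets (V - S) (k - r))
        \<subseteq> {T \<in> nsets V k. card (S \<inter> T) = r}"
    proof clarify
      fix A B assume "A \<in> nsets S r" "B \<in> nsets (V - S) (k - r)"
      then have AB: "A \<subseteq> S" "finite A" "card A = r" "B \<subseteq> V - S" "finite B" "card B = k - r"
        by (auto simp: nsets_def)
      then have "A \<inter> B = {}" "S \<inter> (A \<union> B) = A" by auto
      then show "A \<union> B \<in> nsets V k \<and> card (S \<inter> (A \<union> B)) = r"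
        using AB S' \<open>r \<le> k\<close> by (auto simp: nsets_def card_Un_disjoint)
    qed
    show "(\<lambda>T. (S \<inter> T, T - S)) ` {T \<in> nsets V k. card (S \<inter> T) = r}
        \<subseteq> nsets S r \<times> nsets (V - S) (k - r)"
      using S' by (auto simp: nsets_def card_Diff_subset_Int Int_commute)
  qed (auto simp: nsets_def)
  then have "card {T \<in> nsets V k. card (S \<inter> T) = r} = card (nsets S r \<times> nsets (V - S) (k - r))"
    by (rule bij_betw_same_card[symmetric])
  then show ?thesis using S' V by (simp add: card_cartesian_product card_nsets card_Diff_subset)
qed

text \<open>Since \<open>r < k\<close>, a set that overlaps \<open>S\<close> in \<open>r\<close> elements differs from \<open>S\<close>, so the edges
  at \<open>S\<close> correspond to the overlapping sets.\<close>

lemma overlap_graph_degree: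
  assumes V: "finite V" and S: "S \<in> nsets V k" and "r < k"
  shows "card {e \<in> overlap_pairs r (nsets V k). S \<in> e}
       = (k choose r) * ((card V - k) choose (k - r))"
proof -
  have "card S = k" using S by (simp add: nsets_def)
  then have neq: "T \<noteq> S" if "card (S \<inter> T) = r" for T using that \<open>r < k\<close> by auto
  have "{e \<in> overlap_pairs r (nsets V k). S \<in> e}
      = (\<lambda>T. {S, T}) ` {T \<in> nsets V k. card (S \<inter> T) = r}"
  proof (intro equalityI subsetI)
    fix e assume "e \<in> (\<lambda>T. {S, T}) ` {T \<in> nsets V k. card (S \<inter> T) = r}"
    then show "e \<in> {e \<in> overlap_pairs r (nsets V k). S \<in> e}"
      using S neq unfolding overlap_pairs_def by blast
  next
    fix e assume "e \<in> {e \<in> overlap_pairs r (nsets V k). S \<in> e}"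
    then show "e \<in> (\<lambda>T. {S, T}) ` {T \<in> nsets V k. card (S \<inter> T) = r}"
      unfolding overlap_pairs_def by (auto simp: Int_commute insert_commute)
  qed
  moreover have "inj_on (\<lambda>T. {S, T}) {T \<in> nsets V k. card (S \<inter> T) = r}"
    by (rule inj_onI) (auto simp: doubleton_eq_iff)
  ultimately show ?thesis
    using card_nsets_overlapping[OF V S] \<open>r < k\<close> by (simp add: card_image)
qed

text \<open>Counting incidences between \<open>k\<close>-sets and edges in two ways.\<close>

lemma card_overlap_pairs:
  assumes V: "finite V" and "r < k"
  shows "2 * card (overlap_pairs r (nsets V k))
       = (card V choose k) * ((k choose r) * ((card V - k) choose (k - r)))"
proof -
  let ?W = "nsets V k" and ?E = "overlap_pairs r (nsets V k)"
  have W: "finite ?W" by (rule finite_imp_finite_nsets[OF V])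
  have E: "finite ?E" using finite_subset[OF overlap_pairs_subset_nsets] finite_imp_finite_nsets[OF W] by blast
  have "(\<Sum>S\<in>?W. card {e \<in> ?E. S \<in> e}) = 2 * card ?E"
  proof (rule sum_multicount[OF W E], rule ballI)
    fix e assume "e \<in> ?E"
    then have "e \<subseteq> ?W" "card e = 2"
      using overlap_pairs_subset_nsets[of r ?W] by (auto simp: nsets_def[of ?W])
    then show "card {S \<in> ?W. S \<in> e} = 2" by (simp add: Collect_conj_eq Int_absorb1)
  qed
  then show ?thesis using overlap_graph_degree[OF V _ \<open>r < k\<close>] by (simp add: card_nsets)
qed

theorem theorem4:
  fixes V :: "nat \<Rightarrow> 'a set" and k r :: "nat \<Rightarrow> nat" and p lam :: "nat \<Rightarrow> real" and n\<^sub>0 :: nat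
  assumes ground: "\<And>n. n \<ge> n\<^sub>0 \<Longrightarrow> finite (V n) \<and> card (V n) = n"
    and k_pos: "\<And>n. n \<ge> n\<^sub>0 \<Longrightarrow> 0 < k n"
    and n_gt: "\<And>n. n \<ge> n\<^sub>0 \<Longrightarrow> n > 2 * k n"
    and k_lim: "filterlim k at_top sequentially"
    and r_range: "\<And>n. n \<ge> n\<^sub>0 \<Longrightarrow> 1 \<le> r n \<and> r n \<le> k n - 1"
    and p_range: "\<And>n. n \<ge> n\<^sub>0 \<Longrightarrow> 0 \<le> p n \<and> p n \<le> 1"
    and p_small: "p \<in> o(\<lambda>n. 1 / (real (k n choose r n) * real ((n - k n) choose (k n - r n))))"
    and lambda: "\<And>n. lam n =
      measure_pmf.expectation (random_family (V n) (k n) (p n)) (\<lambda>F. real (overlap_count (r n) F))"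
  shows "(\<forall>n\<ge>n\<^sub>0. lam n =
            1 / 2 * real (n choose k n) * real (k n choose r n)
              * real ((n - k n) choose (k n - r n)) * (p n)\<^sup>2)
       \<and> (\<lambda>n. d_TV (map_pmf (overlap_count (r n)) (random_family (V n) (k n) (p n))) (Po (lam n)))
            \<longlonglongrightarrow> 0"
proof -
  define D where "D n = real (k n choose r n) * real ((n - k n) choose (k n - r n))" for n
  define E where "E n = overlap_pairs (r n) (nsets (V n) (k n))" for n
  have fam: "random_family (V n) (k n) (p n) = random_subset (nsets (V n) (k n)) (p n)" for n
    by (simp add: random_family_def random_subset_def)
  have count: "overlap_count (r n) F = spanned_edges (E n) F"
    if "F \<in> set_pmf (random_subset (nsets (V n) (k n)) (p n))" for n F
    using that unfolding E_def
    by (intro overlap_count_eq_spanned_edges) (auto simp: random_subset_def)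
  have rk: "r n < k n" if "n \<ge> n\<^sub>0" for n using r_range[OF that] k_pos[OF that] by linarith
  have W: "finite (nsets (V n) (k n))" if "n \<ge> n\<^sub>0" for n
    using ground[OF that] finite_imp_finite_nsets by blast
  have E: "E n \<subseteq> nsets (nsets (V n) (k n)) 2" for n
    unfolding E_def by (rule overlap_pairs_subset_nsets)
  have lam_E: "lam n = real (card (E n)) * (p n)\<^sup>2" if n: "n \<ge> n\<^sub>0" for n
  proof -
    have "lam n = measure_pmf.expectation (random_subset (nsets (V n) (k n)) (p n))
        (\<lambda>F. real (spanned_edges (E n) F))"
      unfolding lambda fam by (intro integral_cong_AE) (auto simp: AE_measure_pmf_iff count)
    then show ?thesis using expectation_spanned_edges[OF W[OF n] _ _ E] p_range[OF n] by simp
  qed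
  have lam: "lam n = 1 / 2 * real (n choose k n) * D n * (p n)\<^sup>2" if n: "n \<ge> n\<^sub>0" for n
  proof -
    have "2 * card (E n) = (n choose k n) * ((k n choose r n) * ((n - k n) choose (k n - r n)))"
      unfolding E_def using card_overlap_pairs[of "V n" "r n" "k n"] ground[OF n] rk[OF n] by simp
    then have "2 * real (card (E n)) = real (n choose k n) * D n"
      unfolding D_def by (metis of_nat_mult of_nat_numeral)
    then show ?thesis using lam_E[OF n] by simp
  qed
  let ?d = "\<lambda>n. d_TV (map_pmf (overlap_count (r n)) (random_family (V n) (k n) (p n))) (Po (lam n))"
  have bound: "?d n \<le> 2 * (D n * p n)" if n: "n \<ge> n\<^sub>0" for n
  proof -
    have "map_pmf (overlap_count (r n)) (random_family (V n) (k n) (p n))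
        = map_pmf (spanned_edges (E n)) (random_subset (nsets (V n) (k n)) (p n))"
      unfolding fam by (intro map_pmf_cong count refl)
    moreover have "real (card {e \<in> E n. S \<in> e}) \<le> D n" if "S \<in> nsets (V n) (k n)" for S
      unfolding E_def D_def using overlap_graph_degree[OF _ that rk[OF n]] ground[OF n] by simp
    moreover have "0 \<le> D n" by (simp add: D_def)
    ultimately show ?thesis
      using d_TV_spanned_edges_Poisson[OF W[OF n] E[of n], of "p n" "D n"] p_range[OF n] lam_E[OF n]
      by (simp add: mult.assoc)
  qed
  have "(\<lambda>n. p n / (1 / D n)) \<longlonglongrightarrow> 0"
    using p_small unfolding D_def[symmetric] by (rule smalloD_tendsto)
  then have "(\<lambda>n. 2 * (D n * p n)) \<longlonglongrightarrow> 2 * 0"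
    by (intro tendsto_mult tendsto_const) (simp add: mult.commute)
  then have "(\<lambda>n. 2 * (D n * p n)) \<longlonglongrightarrow> 0" by simp
  then have "?d \<longlonglongrightarrow> 0"
    by (rule tendsto_sandwich[rotated 3, where f = "\<lambda>_. 0"])
       (use bound in \<open>auto intro!: always_eventually d_TV_nonneg eventually_sequentiallyI[of n\<^sub>0]\<close>)
  then show ?thesis using lam by (simp add: D_def mult.assoc)
qed

end
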